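(* Let $X\in\mathbb{R}^{n\times p}$, $0\neq\beta\in\mathbb{R}^p$, $\varepsilon\in\mathbb{R}^n$, $Y=X\beta+\varepsilon$ and $\Lambda\in\mathbb{R}^{p+}$. Let $M=\mathrm{patt}(\beta)\in\mathcal{P}^{\rm SLOPE}_p$ and $k=\|M\|_\infty$. Define $$\pi=X'(\tilde X_M')^+\tilde\Lambda_M+X'(I_n-\tilde P_M)Y .$$ Then there exists $\hat\beta\in S_{X,\Lambda}(Y)$ with $\mathrm{patt}(\hat\beta)=\mathrm{patt}(\beta)$ if and only if both of the following conditions hold: (positivity condition) there exists $s\in\mathbb{R}^{k+}$ such that $\tilde X_M'Y-\tilde\Lambda_M=\tilde X_M'\tilde X_M s$; (subdifferential condition) $\pi\in\partial J_\Lambda(M)$. Moreover, if the positivity and subdifferential conditions are satisfied (with $s$ as in the positivity condition), then $\hat\beta=U_M s\in S_{X,\Lambda}(Y)$ and $\pi=X'(Y-X\hat\beta)$.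
   Context: Notation: $A'$ is the transpose, $A^+$ the Moore-Penrose pseudo-inverse, $\|\cdot\|_\infty$ the maximum absolute entry. $\mathbb{R}^{k+}=\{\kappa\in\mathbb{R}^k:\kappa_1>\dots>\kappa_k>0\}$. SLOPE pattern: for $b\in\mathbb{R}^p$, $\mathrm{patt}(b)_i=\mathrm{sign}(b_i)\,\mathrm{rank}(|b|)_i$, where $k$ is the number of distinct nonzero values in $\{|b_1|,\dots,|b_p|\}$, $\mathrm{rank}(|b|)_i\in\{0,1,\dots,k\}$, $\mathrm{rank}(|b|)_i=0$ if $b_i=0$, $\mathrm{rank}(|b|)_i>0$ if $b_i\ne0$, and $\mathrm{rank}(|b|)_i<\mathrm{rank}(|b|)_j$ if $|b_i|<|b_j|$ (so $\mathrm{rank}(|b|)_i$ is the number of distinct nonzero values of $|b_1|,\dots,|b_p|$ that are $\le|b_i|$). $\mathcal{P}^{\rm SLOPE}_p=\mathrm{patt}(\mathbb{R}^p)$. For $0\ne M\in\mathcal{P}^{\rm SLOPE}_p$ with $k=\|M\|_\infty$, the pattern matrix $U_M\in\mathbb{R}^{p\times k}$ is $(U_M)_{ij}=\mathrm{sign}(M_i)\mathbf 1_{(|M_i|=k+1-j)}$. $|M|_\downarrow$ is the vector of absolute values of the components of $M$ in nonincreasing order. $\tilde X_M=XU_M$, $\tilde\Lambda_M=(U_{|M|_\downarrow})'\Lambda\in\mathbb{R}^k$, and $\tilde P_M=\tilde X_M\tilde X_M^+$ is the orthogonal projection onto the column space of $\tilde X_M$. For $\Lambda=(\lambda_1,\dots,\lambda_p)'\in\mathbb{R}^{p+}$,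 the sorted $\ell_1$ norm is $J_\Lambda(b)=\sum_{i=1}^p\lambda_i|b|_{(i)}$, where $|b|_{(1)}\ge\dots\ge|b|_{(p)}$ are the sorted absolute values of the components of $b$; $\partial J_\Lambda(b)=\{v\in\mathbb{R}^p: J_\Lambda(z)\ge J_\Lambda(b)+v'(z-b)\ \forall z\in\mathbb{R}^p\}$ is its subdifferential. $S_{X,\Lambda}(Y)=\arg\min_{b\in\mathbb{R}^p}\{\frac12\|Y-Xb\|_2^2+J_\Lambda(b)\}$ is the set of SLOPE minimizers. *)

theory Defs
  imports Complex_Main "Jordan_Normal_Form.Matrix"
begin

(* The dimension k of the reduced problem depends on the vector beta, so vectors and matrices
   are those of Jordan_Normal_Form, with dimensions that are natural numbers.  Indices start
   at 0. *)

definition linf_norm :: "real vec \<Rightarrow> real" where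
  "linf_norm v = Max {\<bar>v $ i\<bar> | i. i < dim_vec v}"

definition decreasing_positive :: "nat \<Rightarrow> real vec set" where
  "decreasing_positive k = {\<kappa> \<in> carrier_vec k.
     (\<forall>i<k. 0 < \<kappa> $ i) \<and> (\<forall>i<k. \<forall>j<k. i < j \<longrightarrow> \<kappa> $ j < \<kappa> $ i)}"

definition is_mp_inverse :: "real mat \<Rightarrow> real mat \<Rightarrow> bool" where
  "is_mp_inverse A B \<longleftrightarrow>
     B \<in> carrier_mat (dim_col A) (dim_row A) \<and>
     A * B * A = A \<and> B * A * B = B \<and>
     transpose_mat (A * B) = A * B \<and> transpose_mat (B * A) = B * A"

(* Every real matrix has exactly one such B; uniqueness is proved below. *)
definition mp_inverse :: "real mat \<Rightarrow> real mat" where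
  "mp_inverse A = (THE B. is_mp_inverse A B)"

lemma is_mp_inverse_unique:
  assumes "is_mp_inverse A B" and "is_mp_inverse A C"
  shows "B = C"
proof -
  define m n where "m = dim_row A" and "n = dim_col A"
  have A: "A \<in> carrier_mat m n" by (simp add: m_def n_def)
  have B: "B \<in> carrier_mat n m" and C: "C \<in> carrier_mat n m"
    using assms by (auto simp: is_mp_inverse_def m_def n_def)
  have AB: "A * B \<in> carrier_mat m m" and AC: "A * C \<in> carrier_mat m m"
    and BA: "B * A \<in> carrier_mat n n" and CA: "C * A \<in> carrier_mat n n"
    using A B C by auto
  have b: "A * B * A = A" "B * A * B = B"
       "transpose_mat (A * B) = A * B" "transpose_mat (B * A) = B * A"
    and c: "A * C * A = A" "C * A * C = C"
       "transpose_mat (A * C) = A * C" "transpose_mat (C * A) = C * A"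
    using assms by (auto simp: is_mp_inverse_def)
  have 1: "A * B = A * C"
  proof -
    have "A * B = transpose_mat ((A * C * A) * B)" by (simp add: b c)
    also have "(A * C * A) * B = (A * C) * (A * B)" using AC A B by (simp add: assoc_mult_mat)
    also have "transpose_mat \<dots> = (A * B) * (A * C)"
      by (simp add: transpose_mult[OF AC AB] b c)
    also have "\<dots> = (A * B * A) * C" by (rule assoc_mult_mat[symmetric, OF AB A C])
    finally show ?thesis by (simp add: b)
  qed
  have 2: "B * A = C * A"
  proof -
    have "B * A = transpose_mat (B * (A * C * A))" by (simp add: b c)
    also have "A * C * A = A * (C * A)" by (rule assoc_mult_mat[OF A C A])
    also have "B * (A * (C * A)) = (B * A) * (C * A)"
      by (rule assoc_mult_mat[symmetric, OF B A CA])
    also have "transpose_mat \<dots> = (C * A) * (B * A)"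
      by (simp add: transpose_mult[OF BA CA] b c)
    also have "\<dots> = C * (A * (B * A))" by (rule assoc_mult_mat[OF C A BA])
    also have "A * (B * A) = A * B * A" by (rule assoc_mult_mat[symmetric, OF A B A])
    finally show ?thesis by (simp add: b)
  qed
  have "B = C * A * B" using b(2) 2 by simp
  also have "\<dots> = C * (A * B)" by (rule assoc_mult_mat[OF C A B])
  also have "\<dots> = C * A * C" unfolding 1 by (rule assoc_mult_mat[symmetric, OF C A C])
  finally show ?thesis by (simp add: c)
qed

definition abs_rank :: "real vec \<Rightarrow> nat \<Rightarrow> nat" where
  "abs_rank b i = card {\<bar>b $ j\<bar> | j. j < dim_vec b \<and> b $ j \<noteq> 0 \<and> \<bar>b $ j\<bar> \<le> \<bar>b $ i\<bar>}"

definition patt :: "real vec \<Rightarrow> real vec" where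
  "patt b = vec (dim_vec b) (\<lambda>i. sgn (b $ i) * real (abs_rank b i))"

(* The sup norm of a pattern is a natural number (lemma below), so the floor only changes
   the type.  The entry condition is |M_i| = k + 1 - j for the 1-based column index j. *)
definition pattern_matrix :: "real vec \<Rightarrow> real mat" where
  "pattern_matrix M =
     (let k = nat \<lfloor>linf_norm M\<rfloor>
      in mat (dim_vec M) k (\<lambda>(i, j). if \<bar>M $ i\<bar> = real (k - j) then sgn (M $ i) else 0))"

lemma linf_norm_patt_Nats:
  assumes "0 < dim_vec b"
  shows "linf_norm (patt b) \<in> \<nat>"
proof -
  let ?S = "{\<bar>patt b $ i\<bar> | i. i < dim_vec (patt b)}"
  have "Max ?S \<in> ?S"
    using assms by (intro Max_in) (auto simp: patt_def intro!: exI[of _ 0])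
  then obtain i where "i < dim_vec b" "linf_norm (patt b) = \<bar>patt b $ i\<bar>"
    by (auto simp: patt_def linf_norm_def)
  then have "linf_norm (patt b) = real (if b $ i = 0 then 0 else abs_rank b i)"
    by (auto simp: patt_def abs_mult abs_sgn_eq)
  then show ?thesis by (metis of_nat_in_Nats)
qed

definition abs_sorted :: "real vec \<Rightarrow> real vec" where
  "abs_sorted b = vec_of_list (rev (sort (map abs (list_of_vec b))))"

definition sorted_l1 :: "real vec \<Rightarrow> real vec \<Rightarrow> real" where
  "sorted_l1 \<Lambda> b = (\<Sum>i<dim_vec b. \<Lambda> $ i * abs_sorted b $ i)"

definition subdiff_sorted_l1 :: "real vec \<Rightarrow> real vec \<Rightarrow> real vec set" where
  "subdiff_sorted_l1 \<Lambda> b = {v \<in> carrier_vec (dim_vec b).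
     \<forall>z \<in> carrier_vec (dim_vec b). sorted_l1 \<Lambda> z \<ge> sorted_l1 \<Lambda> b + v \<bullet> (z - b)}"

definition slope_objective :: "real mat \<Rightarrow> real vec \<Rightarrow> real vec \<Rightarrow> real vec \<Rightarrow> real" where
  "slope_objective X \<Lambda> Y b =
     1 / 2 * ((Y - X *\<^sub>v b) \<bullet> (Y - X *\<^sub>v b)) + sorted_l1 \<Lambda> b"

definition slope_minimizers :: "real mat \<Rightarrow> real vec \<Rightarrow> real vec \<Rightarrow> real vec set" where
  "slope_minimizers X \<Lambda> Y =
     {b. is_arg_min (slope_objective X \<Lambda> Y) (\<lambda>c. c \<in> carrier_vec (dim_col X)) b}"

definition reduced_design :: "real mat \<Rightarrow> real vec \<Rightarrow> real mat" where
  "reduced_design X M = X * pattern_matrix M"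

definition reduced_weights :: "real vec \<Rightarrow> real vec \<Rightarrow> real vec" where
  "reduced_weights \<Lambda> M = transpose_mat (pattern_matrix (abs_sorted M)) *\<^sub>v \<Lambda>"

definition reduced_projection :: "real mat \<Rightarrow> real vec \<Rightarrow> real mat" where
  "reduced_projection X M = reduced_design X M * mp_inverse (reduced_design X M)"

definition slope_pi :: "real mat \<Rightarrow> real vec \<Rightarrow> real vec \<Rightarrow> real vec \<Rightarrow> real vec" where
  "slope_pi X \<Lambda> Y M =
     transpose_mat X *\<^sub>v
       (mp_inverse (transpose_mat (reduced_design X M)) *\<^sub>v reduced_weights \<Lambda> M)
     + transpose_mat X *\<^sub>v ((1\<^sub>m (dim_row X) - reduced_projection X M) *\<^sub>v Y)"

definition positivity_at :: "real mat \<Rightarrow> real vec \<Rightarrow> real vec \<Rightarrow> real vec \<Rightarrow> real vec \<Rightarrow> bool" where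
  "positivity_at X \<Lambda> Y M s \<longleftrightarrow>
     transpose_mat (reduced_design X M) *\<^sub>v Y - reduced_weights \<Lambda> M
       = transpose_mat (reduced_design X M) *\<^sub>v (reduced_design X M *\<^sub>v s)"

end

theory Submission
  imports Defs "HOL-Library.Multiset"
begin

text \<open>
  Write \<open>J\<close> for the sorted norm, \<open>U\<close> for the pattern matrix of \<open>M\<close>, \<open>A = X U\<close> for the reduced design
  and \<open>W\<close> for the reduced weights.

  The vectors with pattern \<open>M\<close> are exactly the vectors \<open>U s\<close> with \<open>s\<close> positive and decreasing
  (\<open>patt_pattern_matrix_mult\<close>, \<open>pattern_decomposition\<close>): the coordinates of \<open>s\<close> are the distinct
  nonzero absolute values. On this open cone \<open>J (U s) = W \<bullet> s\<close> is linear
  (\<open>sorted_l1_pattern_matrix_mult\<close>). Since \<open>J\<close> is positively homogeneous, \<open>v\<close> is a subgradient at \<open>b\<close>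
  iff \<open>v \<bullet> z \<le> J z\<close> for all \<open>z\<close>, with equality at \<open>z = b\<close>. For \<open>b = U s\<close> the equality can be
  replaced by \<open>U\<^sup>T v = W\<close>, because a linear form dominated by another one on an open cone and equal to
  it at one point is that form (\<open>subdiff_pattern_matrix_mult_iff\<close>). So all vectors with pattern \<open>M\<close>
  have the subdifferential of \<open>M\<close>.

  By Fermat's rule (\<open>slope_minimizers_iff\<close>) the vector \<open>U s\<close> is a minimizer iff
  \<open>v = X\<^sup>T (Y - X U s)\<close> is a subgradient at \<open>M\<close>. If it is, then \<open>U\<^sup>T v = W\<close>, which is the
  positivity condition for \<open>s\<close>. In turn, positivity at \<open>s\<close> implies \<open>\<pi> = v\<close> (\<open>slope_pi_eq\<close>), for
  \<open>(A\<^sup>T)\<^sup>+ A\<^sup>T = A A\<^sup>+\<close> is the projection onto the column space of \<open>A\<close>. All claims follow.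

  Two ingredients are classical. Fermat's rule needs the convexity of \<open>J\<close>, which comes from the
  rearrangement inequality. The formula for \<open>\<pi>\<close> needs the existence of Moore-Penrose inverses, which
  are built here from generalized inverses of \<open>A\<^sup>T A\<close> and \<open>A A\<^sup>T\<close>.
\<close>

section \<open>Sorting and the rearrangement inequality\<close>

lemma sort_map_mono_on:
  fixes g :: "'a::linorder \<Rightarrow> 'b::linorder"
  assumes "mono_on (set xs) g"
  shows "sort (map g xs) = map g (sort xs)"
proof (rule properties_for_sort)
  have "sorted_wrt (\<lambda>x y. g x \<le> g y) (sort xs)"
    by (rule sorted_wrt_mono_rel[OF _ sorted_sort[of xs]])
       (use assms in \<open>auto dest: mono_onD\<close>)
  then show "sorted (map g (sort xs))"
    by (simp add: sorted_map)
qed simp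

lemma sum_mult_nth_le_insort_desc:
  fixes w :: "nat \<Rightarrow> real"
  assumes "\<And>i j. i \<le> j \<Longrightarrow> j \<le> length ys \<Longrightarrow> w j \<le> w i"
  shows "(\<Sum>i<Suc (length ys). w i * (x # ys) ! i)
       \<le> (\<Sum>i<Suc (length ys). w i * insort_key uminus x ys ! i)"
  using assms
proof (induction ys arbitrary: w)
  case Nil
  then show ?case by simp
next
  case (Cons y ys)
  show ?case
  proof (cases "y \<le> x")
    case True
    then show ?thesis by simp
  next
    case False
    have IH: "(\<Sum>i<Suc (length ys). w (Suc i) * (x # ys) ! i)
       \<le> (\<Sum>i<Suc (length ys). w (Suc i) * insort_key uminus x ys ! i)"
      by (rule Cons.IH) (use Cons.prems in auto)
    \<comment> \<open>Exchanging the leading pair changes the sum by \<open>(w 0 - w 1) * (y - x)\<close>.\<close>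
    have "0 \<le> (w 0 - w 1) * (y - x)"
      using False Cons.prems[of 0 1] by simp
    then have "w 0 * x + w 1 * y \<le> w 0 * y + w 1 * x"
      by (simp add: algebra_simps)
    with IH False show ?thesis
      by (simp add: sum.lessThan_Suc_shift del: sum.lessThan_Suc)
  qed
qed

lemma sort_desc_eq_rev_sort:
  fixes f :: "'a \<Rightarrow> real"
  shows "map f (sort_key (\<lambda>x. - f x) xs) = rev (sort (map f xs))"
proof -
  have "sorted (map (\<lambda>x. - f x) (sort_key (\<lambda>x. - f x) xs))"
    by (rule sorted_sort_key)
  then have "sorted (rev (map f (sort_key (\<lambda>x. - f x) xs)))"
    by (simp add: sorted_wrt_rev sorted_wrt_map sorted_map)
  then have "sort (map f xs) = rev (map f (sort_key (\<lambda>x. - f x) xs))"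
    by (intro properties_for_sort) simp_all
  then show ?thesis by simp
qed

text \<open>The rearrangement inequality for nonincreasing weights. Insertion sort moves each entry to
  its place by exchanges of neighbours, none of which decreases the sum.\<close>

lemma rearrangement_desc:
  fixes w :: "nat \<Rightarrow> real"
  assumes "\<And>i j. i \<le> j \<Longrightarrow> j < length xs \<Longrightarrow> w j \<le> w i"
  shows "(\<Sum>i<length xs. w i * xs ! i) \<le> (\<Sum>i<length xs. w i * rev (sort xs) ! i)"
proof -
  have "(\<Sum>i<length xs. w i * xs ! i) \<le> (\<Sum>i<length xs. w i * sort_key uminus xs ! i)"
    using assms
  proof (induction xs arbitrary: w)
    case Nil
    then show ?case by simp
  next
    case (Cons x xs)
    have "(\<Sum>i<length xs. w (Suc i) * xs ! i)
        \<le> (\<Sum>i<length xs. w (Suc i) * sort_key uminus xs ! i)"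
      by (rule Cons.IH) (use Cons.prems in auto)
    then have "(\<Sum>i<length (x # xs). w i * (x # xs) ! i)
        \<le> (\<Sum>i<Suc (length xs). w i * (x # sort_key uminus xs) ! i)"
      by (simp add: sum.lessThan_Suc_shift del: sum.lessThan_Suc)
    also have "\<dots> \<le> (\<Sum>i<Suc (length xs). w i * insort_key uminus x (sort_key uminus xs) ! i)"
      using sum_mult_nth_le_insort_desc[of "sort_key uminus xs" w x] Cons.prems by simp
    finally show ?case by simp
  qed
  then show ?thesis
    using sort_desc_eq_rev_sort[of "\<lambda>x. x" xs] by simp
qed

section \<open>The sorted l1 norm\<close>

lemma abs_sorted_eq: "abs_sorted b = vec_of_list (rev (sort (map (\<lambda>j. \<bar>b $ j\<bar>) [0..<dim_vec b])))"
  by (simp add: abs_sorted_def list_of_vec_map comp_def)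

lemma dim_abs_sorted [simp]: "dim_vec (abs_sorted b) = dim_vec b"
  by (simp add: abs_sorted_eq)

lemma abs_sorted_index:
  "i < dim_vec b \<Longrightarrow> abs_sorted b $ i = rev (sort (map (\<lambda>j. \<bar>b $ j\<bar>) [0..<dim_vec b])) ! i"
  by (simp add: abs_sorted_eq vec_of_list_index)

lemma abs_sorted_image:
  "(\<lambda>i. abs_sorted b $ i) ` {..<dim_vec b} = (\<lambda>i. \<bar>b $ i\<bar>) ` {..<dim_vec b}"
proof -
  let ?l = "rev (sort (map (\<lambda>j. \<bar>b $ j\<bar>) [0..<dim_vec b]))"
  have "(\<lambda>i. abs_sorted b $ i) ` {..<dim_vec b} = (!) ?l ` {..<length ?l}"
    by (intro image_cong) (auto simp: abs_sorted_index)
  also have "\<dots> = set ?l" by (auto simp: set_conv_nth)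
  finally show ?thesis by (simp add: atLeast0LessThan)
qed

lemma abs_sorted_mono_map:
  assumes "dim_vec c = dim_vec b"
    and "\<And>i. i < dim_vec b \<Longrightarrow> \<bar>c $ i\<bar> = g \<bar>b $ i\<bar>"
    and "mono_on ((\<lambda>i. \<bar>b $ i\<bar>) ` {..<dim_vec b}) g"
    and "i < dim_vec b"
  shows "abs_sorted c $ i = g (abs_sorted b $ i)"
proof -
  have "map (\<lambda>j. \<bar>c $ j\<bar>) [0..<dim_vec c] = map g (map (\<lambda>j. \<bar>b $ j\<bar>) [0..<dim_vec b])"
    using assms by simp
  also have "sort \<dots> = map g (sort (map (\<lambda>j. \<bar>b $ j\<bar>) [0..<dim_vec b]))"
    by (rule sort_map_mono_on) (use assms in \<open>simp add: atLeast0LessThan\<close>)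
  finally show ?thesis
    using assms(1,4) by (simp add: abs_sorted_index rev_map)
qed

text \<open>The sorted norm is the largest of the weighted \<open>l1\<close> norms obtained by permuting the
  weights. A maximum of seminorms is a seminorm, which gives the convexity behind the optimality
  condition.\<close>

lemma sorted_l1_ge_arrangement:
  assumes "\<Lambda> \<in> decreasing_positive (dim_vec b)" and "mset js = mset [0..<dim_vec b]"
  shows "(\<Sum>i<dim_vec b. \<Lambda> $ i * \<bar>b $ (js ! i)\<bar>) \<le> sorted_l1 \<Lambda> b"
proof -
  let ?xs = "map (\<lambda>j. \<bar>b $ j\<bar>) js"
  have len: "length js = dim_vec b"
    using assms(2) by (metis diff_zero length_upt size_mset)
  have "sort (map (\<lambda>j. \<bar>b $ j\<bar>) [0..<dim_vec b]) = sort ?xs"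
    by (rule properties_for_sort) (simp_all add: assms(2))
  moreover have "\<Lambda> $ j \<le> \<Lambda> $ i" if "i \<le> j" "j < length ?xs" for i j
    using assms(1) that len by (cases "i = j") (auto simp: decreasing_positive_def intro!: less_imp_le)
  then have "(\<Sum>i<length ?xs. \<Lambda> $ i * ?xs ! i) \<le> (\<Sum>i<length ?xs. \<Lambda> $ i * rev (sort ?xs) ! i)"
    by (rule rearrangement_desc)
  ultimately show ?thesis
    by (simp add: sorted_l1_def abs_sorted_index len)
qed

lemma sorted_l1_attained:
  obtains js where "mset js = mset [0..<dim_vec b]"
    and "sorted_l1 \<Lambda> b = (\<Sum>i<dim_vec b. \<Lambda> $ i * \<bar>b $ (js ! i)\<bar>)"
proof
  let ?js = "sort_key (\<lambda>j. - \<bar>b $ j\<bar>) [0..<dim_vec b]"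
  show "mset ?js = mset [0..<dim_vec b]" by simp
  have "abs_sorted b $ i = \<bar>b $ (?js ! i)\<bar>" if "i < dim_vec b" for i
    using that arg_cong[OF sort_desc_eq_rev_sort[of "\<lambda>j. \<bar>b $ j\<bar>" "[0..<dim_vec b]"], of "\<lambda>l. l ! i"]
    by (simp add: abs_sorted_index)
  then show "sorted_l1 \<Lambda> b = (\<Sum>i<dim_vec b. \<Lambda> $ i * \<bar>b $ (?js ! i)\<bar>)"
    by (simp add: sorted_l1_def)
qed

lemma sorted_l1_add_le:
  assumes L: "\<Lambda> \<in> decreasing_positive p" and a: "a \<in> carrier_vec p" and b: "b \<in> carrier_vec p"
  shows "sorted_l1 \<Lambda> (a + b) \<le> sorted_l1 \<Lambda> a + sorted_l1 \<Lambda> b"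
proof -
  obtain js where js: "mset js = mset [0..<dim_vec (a + b)]"
    and eq: "sorted_l1 \<Lambda> (a + b) = (\<Sum>i<dim_vec (a + b). \<Lambda> $ i * \<bar>(a + b) $ (js ! i)\<bar>)"
    by (rule sorted_l1_attained)
  have len: "length js = p" using js b by (metis carrier_vecD diff_zero index_add_vec(2) length_upt size_mset)
  have js_less: "js ! i < p" if "i < p" for i
  proof -
    have "set js = {0..<p}" using js b by (metis carrier_vecD index_add_vec(2) set_mset_mset set_upt)
    then show ?thesis using that len nth_mem by fastforce
  qed
  have "sorted_l1 \<Lambda> (a + b) \<le> (\<Sum>i<p. \<Lambda> $ i * \<bar>a $ (js ! i)\<bar> + \<Lambda> $ i * \<bar>b $ (js ! i)\<bar>)"
  proof -
    have "\<Lambda> $ i * \<bar>(a + b) $ (js ! i)\<bar> \<le> \<Lambda> $ i * \<bar>a $ (js ! i)\<bar> + \<Lambda> $ i * \<bar>b $ (js ! i)\<bar>"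
      if "i < p" for i
    proof -
      have "\<Lambda> $ i * \<bar>(a + b) $ (js ! i)\<bar> \<le> \<Lambda> $ i * (\<bar>a $ (js ! i)\<bar> + \<bar>b $ (js ! i)\<bar>)"
        using that L js_less a b by (intro mult_left_mono) (auto simp: decreasing_positive_def less_imp_le)
      then show ?thesis by (simp add: distrib_left)
    qed
    then show ?thesis unfolding eq using b by (auto intro!: sum_mono)
  qed
  also have "\<dots> \<le> sorted_l1 \<Lambda> a + sorted_l1 \<Lambda> b"
    using sorted_l1_ge_arrangement[of \<Lambda> a js] sorted_l1_ge_arrangement[of \<Lambda> b js] L a b js
    by (simp add: sum.distrib)
  finally show ?thesis .
qed

lemma sorted_l1_smult:
  assumes "0 \<le> t"
  shows "sorted_l1 \<Lambda> (t \<cdot>\<^sub>v b) = t * sorted_l1 \<Lambda> b"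
proof -
  have "abs_sorted (t \<cdot>\<^sub>v b) $ i = t * abs_sorted b $ i" if "i < dim_vec b" for i
    by (rule abs_sorted_mono_map[where g = "(*) t"])
       (use assms that in \<open>auto simp: abs_mult intro!: mono_onI mult_left_mono\<close>)
  then show ?thesis
    by (simp add: sorted_l1_def sum_distrib_left mult.left_commute)
qed

section \<open>Subgradients and the optimality condition\<close>

lemma subdiff_sorted_l1_iff:
  assumes b: "b \<in> carrier_vec p"
  shows "v \<in> subdiff_sorted_l1 \<Lambda> b \<longleftrightarrow>
    v \<in> carrier_vec p \<and> v \<bullet> b = sorted_l1 \<Lambda> b \<and> (\<forall>z \<in> carrier_vec p. v \<bullet> z \<le> sorted_l1 \<Lambda> z)"
    (is "?L \<longleftrightarrow> ?R")
proof
  assume ?L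
  then have v: "v \<in> carrier_vec p"
    using b by (simp add: subdiff_sorted_l1_def)
  have ge: "sorted_l1 \<Lambda> b + v \<bullet> (z - b) \<le> sorted_l1 \<Lambda> z" if "z \<in> carrier_vec p" for z
    using \<open>?L\<close> b that by (auto simp: subdiff_sorted_l1_def)
  have ge': "sorted_l1 \<Lambda> b + v \<bullet> z - v \<bullet> b \<le> sorted_l1 \<Lambda> z" if "z \<in> carrier_vec p" for z
    using ge[OF that] scalar_prod_minus_distrib[OF v that b] by simp
  \<comment> \<open>Both inequalities between \<open>v \<bullet> b\<close> and the norm come from points of the ray through \<open>b\<close>.\<close>
  have "sorted_l1 \<Lambda> b + t * (v \<bullet> b) - v \<bullet> b \<le> t * sorted_l1 \<Lambda> b" if "0 \<le> t" for t
    using ge'[of "t \<cdot>\<^sub>v b"] b v that by (simp add: sorted_l1_smult)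
  from this[of 0] this[of 2] have eq: "v \<bullet> b = sorted_l1 \<Lambda> b" by simp
  with ge' v show ?R by fastforce
next
  assume R: ?R
  then have "v \<bullet> (z - b) = v \<bullet> z - v \<bullet> b" if "z \<in> carrier_vec p" for z
    using scalar_prod_minus_distrib[of v p z b] b that by blast
  with R b show ?L by (auto simp: subdiff_sorted_l1_def)
qed

lemma slope_objective_add:
  assumes X: "X \<in> carrier_mat n p" and Y: "Y \<in> carrier_vec n"
    and b: "b \<in> carrier_vec p" and d: "d \<in> carrier_vec p"
  shows "slope_objective X \<Lambda> Y (b + d) = slope_objective X \<Lambda> Y b
    + (sorted_l1 \<Lambda> (b + d) - sorted_l1 \<Lambda> b - (transpose_mat X *\<^sub>v (Y - X *\<^sub>v b)) \<bullet> d)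
    + 1 / 2 * ((X *\<^sub>v d) \<bullet> (X *\<^sub>v d))"
proof -
  define r e where "r = Y - X *\<^sub>v b" and "e = X *\<^sub>v d"
  have r: "r \<in> carrier_vec n" and e: "e \<in> carrier_vec n"
    using X Y b d by (auto simp: r_def e_def)
  have "Y - X *\<^sub>v (b + d) = r - e"
    unfolding mult_add_distrib_mat_vec[OF X b d] r_def e_def using X Y b d by auto
  moreover have "(r - e) \<bullet> (r - e) = r \<bullet> r - 2 * (r \<bullet> e) + e \<bullet> e"
    using r e by (simp add: minus_scalar_prod_distrib[of _ n] scalar_prod_minus_distrib[of _ n]
        comm_scalar_prod[of e n r])
  moreover have "(transpose_mat X *\<^sub>v r) \<bullet> d = r \<bullet> e"
    unfolding e_def by (rule transpose_vec_mult_scalar[OF X d r])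
  ultimately show ?thesis
    by (simp add: slope_objective_def r_def e_def)
qed

lemma nonneg_if_nonneg_perturbed:
  fixes c q :: real
  assumes "\<And>t. 0 < t \<Longrightarrow> t < 1 \<Longrightarrow> 0 \<le> c + t * q"
  shows "0 \<le> c"
proof -
  have "((\<lambda>t. c + t * q) \<longlongrightarrow> c + 0 * q) (at_right 0)"
    by (intro tendsto_intros)
  moreover have "\<forall>\<^sub>F t in at_right 0. 0 \<le> c + t * q"
    unfolding eventually_at_right_field using assms by (intro exI[of _ 1]) auto
  ultimately show ?thesis
    using tendsto_lowerbound[of "\<lambda>t. c + t * q" "c + 0 * q" "at_right 0" 0] by simp
qed

text \<open>Fermat's rule. Moving from \<open>b\<close> in direction \<open>d\<close> changes the objective by the error of the
  linear lower bound plus a quadratic term. The quadratic term is nonnegative, which gives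
  sufficiency; it is of second order along the segment from \<open>b\<close> to \<open>z\<close>, where convexity bounds
  the increase of the norm, and this gives necessity.\<close>

lemma slope_minimizers_iff:
  assumes X: "X \<in> carrier_mat n p" and Y: "Y \<in> carrier_vec n" and L: "\<Lambda> \<in> decreasing_positive p"
    and b: "b \<in> carrier_vec p"
  shows "b \<in> slope_minimizers X \<Lambda> Y \<longleftrightarrow> transpose_mat X *\<^sub>v (Y - X *\<^sub>v b) \<in> subdiff_sorted_l1 \<Lambda> b"
    (is "_ \<longleftrightarrow> ?v \<in> _")
proof -
  have v: "?v \<in> carrier_vec p" using X Y b by auto
  have min_iff: "b \<in> slope_minimizers X \<Lambda> Y \<longleftrightarrow>
      (\<forall>z \<in> carrier_vec p. slope_objective X \<Lambda> Y b \<le> slope_objective X \<Lambda> Y z)"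
    using X b by (auto simp: slope_minimizers_def is_arg_min_def not_less)
  have sub_iff: "?v \<in> subdiff_sorted_l1 \<Lambda> b \<longleftrightarrow>
      (\<forall>z \<in> carrier_vec p. sorted_l1 \<Lambda> b + ?v \<bullet> (z - b) \<le> sorted_l1 \<Lambda> z)"
    using v b by (auto simp: subdiff_sorted_l1_def)
  show ?thesis
    unfolding min_iff sub_iff
  proof (intro iffI ballI)
    fix z :: "real vec" assume z: "z \<in> carrier_vec p"
    assume "\<forall>z \<in> carrier_vec p. sorted_l1 \<Lambda> b + ?v \<bullet> (z - b) \<le> sorted_l1 \<Lambda> z"
    then have "sorted_l1 \<Lambda> b + ?v \<bullet> (z - b) \<le> sorted_l1 \<Lambda> z" using z by blast
    moreover have "0 \<le> (X *\<^sub>v (z - b)) \<bullet> (X *\<^sub>v (z - b))"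
      by (simp add: scalar_prod_def sum_nonneg)
    moreover have "b + (z - b) = z" using b z by auto
    ultimately show "slope_objective X \<Lambda> Y b \<le> slope_objective X \<Lambda> Y z"
      using slope_objective_add[OF X Y b, of "z - b" \<Lambda>] z b by simp
  next
    fix z :: "real vec" assume z: "z \<in> carrier_vec p"
    assume opt: "\<forall>z \<in> carrier_vec p. slope_objective X \<Lambda> Y b \<le> slope_objective X \<Lambda> Y z"
    define d where "d = z - b"
    define q where "q = 1 / 2 * ((X *\<^sub>v d) \<bullet> (X *\<^sub>v d))"
    have d: "d \<in> carrier_vec p" using z b by (simp add: d_def)
    have "0 \<le> (sorted_l1 \<Lambda> z - sorted_l1 \<Lambda> b - ?v \<bullet> d) + t * q" if t: "0 < t" "t < 1" for t
    proof -
      have "b + t \<cdot>\<^sub>v d = (1 - t) \<cdot>\<^sub>v b + t \<cdot>\<^sub>v z"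
        using b z by (auto simp: d_def algebra_simps)
      then have convex: "sorted_l1 \<Lambda> (b + t \<cdot>\<^sub>v d) \<le> (1 - t) * sorted_l1 \<Lambda> b + t * sorted_l1 \<Lambda> z"
        using sorted_l1_add_le[OF L, of "(1 - t) \<cdot>\<^sub>v b" "t \<cdot>\<^sub>v z"] b z t
        by (simp add: sorted_l1_smult)
      have "(X *\<^sub>v (t \<cdot>\<^sub>v d)) \<bullet> (X *\<^sub>v (t \<cdot>\<^sub>v d)) = t * (t * ((X *\<^sub>v d) \<bullet> (X *\<^sub>v d)))"
        using X d by (simp add: mult_mat_vec)
      moreover have "slope_objective X \<Lambda> Y b \<le> slope_objective X \<Lambda> Y (b + t \<cdot>\<^sub>v d)"
        using opt b d by simp
      ultimately have "0 \<le> sorted_l1 \<Lambda> (b + t \<cdot>\<^sub>v d) - sorted_l1 \<Lambda> b - t * (?v \<bullet> d) + t * t * q"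
        using slope_objective_add[OF X Y b, of "t \<cdot>\<^sub>v d" \<Lambda>] d v
        by (simp add: q_def)
      also have "\<dots> \<le> t * ((sorted_l1 \<Lambda> z - sorted_l1 \<Lambda> b - ?v \<bullet> d) + t * q)"
        using convex by (simp add: algebra_simps)
      finally show ?thesis
        using t by (simp add: zero_le_mult_iff)
    qed
    then have "0 \<le> sorted_l1 \<Lambda> z - sorted_l1 \<Lambda> b - ?v \<bullet> d"
      by (rule nonneg_if_nonneg_perturbed)
    then show "sorted_l1 \<Lambda> b + ?v \<bullet> (z - b) \<le> sorted_l1 \<Lambda> z"
      by (simp add: d_def)
  qed
qed

section \<open>Patterns and pattern matrices\<close>

lemma abs_rank_le_iff:
  assumes "i < dim_vec b" "j < dim_vec b"
  shows "abs_rank b i \<le> abs_rank b j \<longleftrightarrow> \<bar>b $ i\<bar> \<le> \<bar>b $ j\<bar>"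
proof -
  let ?S = "\<lambda>i. {\<bar>b $ l\<bar> | l. l < dim_vec b \<and> b $ l \<noteq> 0 \<and> \<bar>b $ l\<bar> \<le> \<bar>b $ i\<bar>}"
  have fin: "finite (?S i)" for i by simp
  have "abs_rank b i \<le> abs_rank b j" if "\<bar>b $ i\<bar> \<le> \<bar>b $ j\<bar>"
    unfolding abs_rank_def using that by (intro card_mono fin) force
  moreover have "abs_rank b j < abs_rank b i" if less: "\<bar>b $ j\<bar> < \<bar>b $ i\<bar>"
  proof -
    have "\<bar>b $ i\<bar> \<in> ?S i - ?S j" using assms less by auto
    moreover have "?S j \<subseteq> ?S i" using less by force
    ultimately have "?S j \<subset> ?S i" by blast
    then show ?thesis unfolding abs_rank_def by (rule psubset_card_mono[OF fin])
  qed
  ultimately show ?thesis by (meson not_le)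
qed

lemma abs_rank_eq_0_iff:
  assumes "i < dim_vec b"
  shows "abs_rank b i = 0 \<longleftrightarrow> b $ i = 0"
proof -
  have "{\<bar>b $ l\<bar> | l. l < dim_vec b \<and> b $ l \<noteq> 0 \<and> \<bar>b $ l\<bar> \<le> \<bar>b $ i\<bar>} = {} \<longleftrightarrow> b $ i = 0"
    using assms by auto
  then show ?thesis by (simp add: abs_rank_def)
qed

lemma dim_patt [simp]: "dim_vec (patt b) = dim_vec b"
  by (simp add: patt_def)

lemma abs_patt: "i < dim_vec b \<Longrightarrow> \<bar>patt b $ i\<bar> = real (abs_rank b i)"
  by (auto simp: patt_def abs_mult abs_sgn_eq abs_rank_eq_0_iff)

lemma sgn_patt: "i < dim_vec b \<Longrightarrow> sgn (patt b $ i) = sgn (b $ i)"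
  by (auto simp: patt_def sgn_mult sgn_if abs_rank_eq_0_iff)

text \<open>A pattern records the signs and the weak order of the absolute values, and nothing else:
  the ranks count the values of \<open>\<bar>b $ l\<bar>\<close>, and vectors that order their entries alike identify
  the same entries.\<close>

lemma patt_cong:
  assumes dim: "dim_vec c = dim_vec b"
    and sgn: "\<And>i. i < dim_vec b \<Longrightarrow> sgn (c $ i) = sgn (b $ i)"
    and le: "\<And>i j. i < dim_vec b \<Longrightarrow> j < dim_vec b \<Longrightarrow> \<bar>c $ i\<bar> \<le> \<bar>c $ j\<bar> \<longleftrightarrow> \<bar>b $ i\<bar> \<le> \<bar>b $ j\<bar>"
  shows "patt c = patt b"
proof -
  \<comment> \<open>A map that identifies at least the pairs that \<open>g\<close> identifies factors through \<open>g\<close>.\<close>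
  have card_le: "card (f ` J) \<le> card (g ` J)"
    if "finite J" and eq: "\<And>x y. x \<in> J \<Longrightarrow> y \<in> J \<Longrightarrow> g x = g y \<Longrightarrow> f x = f y"
    for f g :: "nat \<Rightarrow> real" and J
  proof -
    have "f ` J \<subseteq> (\<lambda>y. f (inv_into J g y)) ` (g ` J)"
    proof
      fix z assume "z \<in> f ` J"
      then obtain x where x: "x \<in> J" "z = f x" by blast
      then have "f (inv_into J g (g x)) = f x"
        by (intro eq) (auto simp: inv_into_into f_inv_into_f)
      with x show "z \<in> (\<lambda>y. f (inv_into J g y)) ` (g ` J)" by force
    qed
    then show ?thesis using that(1) by (meson surj_card_le finite_imageI)
  qed
  have "abs_rank c i = abs_rank b i" if i: "i < dim_vec b" for i
  proof -
    define J where "J = {l. l < dim_vec b \<and> b $ l \<noteq> 0 \<and> \<bar>b $ l\<bar> \<le> \<bar>b $ i\<bar>}"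
    have J: "J = {l. l < dim_vec c \<and> c $ l \<noteq> 0 \<and> \<bar>c $ l\<bar> \<le> \<bar>c $ i\<bar>}"
      unfolding J_def using dim le[OF _ i] sgn by (metis sgn_0_0)
    have fin: "finite J" by (simp add: J_def)
    have same: "\<bar>c $ x\<bar> = \<bar>c $ y\<bar> \<longleftrightarrow> \<bar>b $ x\<bar> = \<bar>b $ y\<bar>" if "x \<in> J" "y \<in> J" for x y
      using that le[of x y] le[of y x] by (auto simp: J_def)
    have "card ((\<lambda>l. \<bar>c $ l\<bar>) ` J) = card ((\<lambda>l. \<bar>b $ l\<bar>) ` J)"
      by (rule antisym[OF card_le card_le]) (simp_all add: fin same)
    moreover have "abs_rank b i = card ((\<lambda>l. \<bar>b $ l\<bar>) ` J)"
      unfolding abs_rank_def J_def by (rule arg_cong[where f = card]) blast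
    moreover have "abs_rank c i = card ((\<lambda>l. \<bar>c $ l\<bar>) ` J)"
      unfolding abs_rank_def J by (rule arg_cong[where f = card]) blast
    ultimately show ?thesis by simp
  qed
  then show ?thesis
    using dim sgn by (auto simp: patt_def)
qed

text \<open>Patterns are thus the fixed points of \<open>patt\<close>, and the lemmas below refer to them by
  the equation \<open>patt M = M\<close>.\<close>

lemma patt_patt: "patt (patt b) = patt b"
  by (rule patt_cong) (auto simp: sgn_patt abs_patt abs_rank_le_iff)

lemma abs_pattern:
  assumes "patt M = M" "i < dim_vec M"
  shows "\<bar>M $ i\<bar> = real (abs_rank M i)"
  using abs_patt[OF assms(2)] assms(1) by simp

lemma abs_le_linf_norm: "i < dim_vec v \<Longrightarrow> \<bar>v $ i\<bar> \<le> linf_norm v"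
  unfolding linf_norm_def by (rule Max_ge) auto

lemma linf_norm_attained:
  assumes "0 < dim_vec v"
  obtains i where "i < dim_vec v" "\<bar>v $ i\<bar> = linf_norm v"
proof -
  have "linf_norm v \<in> {\<bar>v $ i\<bar> | i. i < dim_vec v}"
    unfolding linf_norm_def using assms by (intro Max_in) auto
  then show ?thesis using that by auto
qed

text \<open>The entry of largest rank \<open>k\<close> counts \<open>k\<close> distinct nonzero values, all of them among
  \<open>1, \<dots>, k\<close>. So none of these numbers is missing.\<close>

lemma pattern_values:
  assumes M: "patt M = M" and dim: "0 < dim_vec M" and k: "real k = linf_norm M"
    and m: "1 \<le> m" "m \<le> k"
  obtains i where "i < dim_vec M" "\<bar>M $ i\<bar> = real m"
proof -
  obtain i where i: "i < dim_vec M" "\<bar>M $ i\<bar> = linf_norm M"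
    using linf_norm_attained[OF dim] .
  let ?R = "{\<bar>M $ l\<bar> | l. l < dim_vec M \<and> M $ l \<noteq> 0 \<and> \<bar>M $ l\<bar> \<le> \<bar>M $ i\<bar>}"
  have "?R \<subseteq> real ` {1..k}"
  proof
    fix x assume "x \<in> ?R"
    then obtain l where l: "l < dim_vec M" "M $ l \<noteq> 0" "x = \<bar>M $ l\<bar>" by blast
    then have "x = real (abs_rank M l)" "1 \<le> abs_rank M l"
      using abs_pattern[OF M l(1)] abs_rank_eq_0_iff[OF l(1)] by auto
    moreover have "x \<le> real k" using l k abs_le_linf_norm by auto
    ultimately show "x \<in> real ` {1..k}" by auto
  qed
  moreover have "card ?R = k"
    using abs_pattern[OF M i(1)] i(2) k by (simp add: abs_rank_def)
  ultimately have "?R = real ` {1..k}"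
    by (intro card_subset_eq) (auto simp: card_image)
  then have "real m \<in> ?R" using m by auto
  then show ?thesis using that by auto
qed

text \<open>The map \<open>cluster_value s\<close> sends the rank \<open>m\<close> to the common absolute value of the
  entries of rank \<open>m\<close> in \<open>U\<^sub>M s\<close>. The largest rank belongs to the first coordinate of \<open>s\<close>.\<close>

definition cluster_value :: "real vec \<Rightarrow> real \<Rightarrow> real" where
  "cluster_value s x = (if x = 0 then 0 else s $ (dim_vec s - nat \<lfloor>x\<rfloor>))"

lemma cluster_value_strict_mono:
  assumes "s \<in> decreasing_positive k" and "a < b" and "b \<le> k"
  shows "cluster_value s (real a) < cluster_value s (real b)"
  using assms by (auto simp: cluster_value_def decreasing_positive_def)

lemma cluster_value_le_iff:
  assumes "s \<in> decreasing_positive k" and "a \<le> k" and "b \<le> k"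
  shows "cluster_value s (real a) \<le> cluster_value s (real b) \<longleftrightarrow> a \<le> b"
  using cluster_value_strict_mono[OF assms(1), of a b] cluster_value_strict_mono[OF assms(1), of b a] assms(2,3)
  by (cases a b rule: linorder_cases) auto

lemma pattern_matrix_carrier:
  assumes "real k = linf_norm M"
  shows "pattern_matrix M \<in> carrier_mat (dim_vec M) k"
  by (simp add: pattern_matrix_def flip: assms)

lemma pattern_matrix_mult_index:
  assumes k: "real k = linf_norm M" and s: "s \<in> carrier_vec k"
    and i: "i < dim_vec M" and nat: "\<bar>M $ i\<bar> \<in> \<nat>"
  shows "(pattern_matrix M *\<^sub>v s) $ i = sgn (M $ i) * cluster_value s \<bar>M $ i\<bar>"
proof -
  obtain m where m: "\<bar>M $ i\<bar> = real m" using nat by (auto elim: Nats_cases)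
  then have mk: "m \<le> k" using abs_le_linf_norm[OF i] k by simp
  have "(pattern_matrix M *\<^sub>v s) $ i = (\<Sum>j = 0..<k. (if m = k - j then sgn (M $ i) else 0) * s $ j)"
    using i s by (simp add: pattern_matrix_def scalar_prod_def m flip: k)
  also have "\<dots> = sgn (M $ i) * cluster_value s \<bar>M $ i\<bar>"
  proof (cases "m = 0")
    case True
    then show ?thesis using m by simp
  next
    case False
    have "(\<Sum>j = 0..<k. (if m = k - j then sgn (M $ i) else 0) * s $ j)
        = (\<Sum>j = 0..<k. if j = k - m then sgn (M $ i) * s $ (k - m) else 0)"
      using mk by (intro sum.cong) auto
    also have "\<dots> = sgn (M $ i) * s $ (k - m)" using False mk by simp
    finally show ?thesis using False s m by (simp add: cluster_value_def)
  qed
  finally show ?thesis .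
qed

lemma cluster_value_pos:
  assumes "s \<in> decreasing_positive k" and "0 < a" and "a \<le> k"
  shows "0 < cluster_value s (real a)"
  using cluster_value_strict_mono[OF assms] by (simp add: cluster_value_def)

lemma
  assumes M: "patt M = M" and k: "real k = linf_norm M" and s: "s \<in> decreasing_positive k"
    and i: "i < dim_vec M"
  shows abs_pattern_matrix_mult: "\<bar>(pattern_matrix M *\<^sub>v s) $ i\<bar> = cluster_value s \<bar>M $ i\<bar>"
    and sgn_pattern_matrix_mult: "sgn ((pattern_matrix M *\<^sub>v s) $ i) = sgn (M $ i)"
proof -
  note abs = abs_pattern[OF M i]
  have le: "abs_rank M i \<le> k" using abs abs_le_linf_norm[OF i] k by simp
  have eq: "(pattern_matrix M *\<^sub>v s) $ i = sgn (M $ i) * cluster_value s \<bar>M $ i\<bar>"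
    by (rule pattern_matrix_mult_index[OF k _ i]) (use s abs in \<open>auto simp: decreasing_positive_def\<close>)
  have "M $ i \<noteq> 0 \<Longrightarrow> 0 < cluster_value s \<bar>M $ i\<bar>"
    unfolding abs using abs_rank_eq_0_iff[OF i] le by (intro cluster_value_pos[OF s]) auto
  then show "\<bar>(pattern_matrix M *\<^sub>v s) $ i\<bar> = cluster_value s \<bar>M $ i\<bar>"
    and "sgn ((pattern_matrix M *\<^sub>v s) $ i) = sgn (M $ i)"
    unfolding eq by (cases "M $ i = 0"; force simp: abs_mult abs_sgn_eq sgn_mult cluster_value_def)+
qed

lemma patt_pattern_matrix_mult:
  assumes M: "patt M = M" and k: "real k = linf_norm M" and s: "s \<in> decreasing_positive k"
  shows "patt (pattern_matrix M *\<^sub>v s) = M"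
proof -
  have "patt (pattern_matrix M *\<^sub>v s) = patt M"
  proof (rule patt_cong)
    show "dim_vec (pattern_matrix M *\<^sub>v s) = dim_vec M"
      using pattern_matrix_carrier[OF k] by simp
    fix i j assume ij: "i < dim_vec M" "j < dim_vec M"
    note abs = abs_pattern[OF M ij(1)] abs_pattern[OF M ij(2)]
    have "abs_rank M i \<le> k" "abs_rank M j \<le> k"
      using abs abs_le_linf_norm[OF ij(1)] abs_le_linf_norm[OF ij(2)] k by simp_all
    then show "\<bar>(pattern_matrix M *\<^sub>v s) $ i\<bar> \<le> \<bar>(pattern_matrix M *\<^sub>v s) $ j\<bar> \<longleftrightarrow> \<bar>M $ i\<bar> \<le> \<bar>M $ j\<bar>"
      using ij abs by (simp add: abs_pattern_matrix_mult[OF M k s] cluster_value_le_iff[OF s])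
  qed (rule sgn_pattern_matrix_mult[OF M k s])
  then show ?thesis using M by simp
qed

text \<open>Conversely, the coordinates of \<open>s\<close> are the distinct nonzero absolute values of \<open>b\<close>, taken
  at representatives \<open>rep m\<close> of the ranks \<open>m\<close>.\<close>

lemma pattern_decomposition:
  assumes dim: "0 < dim_vec b" and k: "real k = linf_norm (patt b)"
  obtains s where "s \<in> decreasing_positive k" and "b = pattern_matrix (patt b) *\<^sub>v s"
proof -
  have "\<forall>m. \<exists>i. 1 \<le> m \<longrightarrow> m \<le> k \<longrightarrow> i < dim_vec b \<and> abs_rank b i = m"
    using pattern_values[OF patt_patt _ k] dim abs_patt by (metis dim_patt of_nat_eq_iff)
  then obtain rep where rep: "\<And>m. 1 \<le> m \<Longrightarrow> m \<le> k \<Longrightarrow> rep m < dim_vec b \<and> abs_rank b (rep m) = m"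
    by metis
  define s where "s = vec k (\<lambda>j. \<bar>b $ (rep (k - j))\<bar>)"
  have s: "s \<in> decreasing_positive k"
  proof -
    have "0 < \<bar>b $ (rep (k - j))\<bar>" if "j < k" for j
      using rep[of "k - j"] that abs_rank_eq_0_iff[of "rep (k - j)" b] by auto
    moreover have "\<bar>b $ (rep (k - j))\<bar> < \<bar>b $ (rep (k - i))\<bar>" if "i < j" "j < k" for i j
      using rep[of "k - j"] rep[of "k - i"] that abs_rank_le_iff[of "rep (k - i)" b "rep (k - j)"] by auto
    ultimately show ?thesis by (auto simp: s_def decreasing_positive_def)
  qed
  have "b $ i = (pattern_matrix (patt b) *\<^sub>v s) $ i" if i: "i < dim_vec b" for i
  proof -
    have mult: "(pattern_matrix (patt b) *\<^sub>v s) $ i = sgn (b $ i) * cluster_value s (real (abs_rank b i))"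
      using pattern_matrix_mult_index[OF k, of s i] i by (simp add: s_def abs_patt sgn_patt)
    show ?thesis
    proof (cases "b $ i = 0")
      case False
      define m where "m = abs_rank b i"
      have m: "1 \<le> m" "m \<le> k"
        using False i abs_rank_eq_0_iff[OF i] abs_le_linf_norm[of i "patt b"] abs_patt[OF i] k
        by (auto simp: m_def)
      then have "\<bar>b $ (rep m)\<bar> = \<bar>b $ i\<bar>"
        using rep[OF m] i abs_rank_le_iff[of i b "rep m"] abs_rank_le_iff[of "rep m" b i]
        by (auto simp: m_def)
      then have "cluster_value s (real m) = \<bar>b $ i\<bar>"
        using m by (simp add: cluster_value_def s_def)
      then show ?thesis by (simp add: mult m_def sgn_mult_abs)
    qed (simp add: mult)
  qed
  then have "b = pattern_matrix (patt b) *\<^sub>v s"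
    using pattern_matrix_carrier[OF k] by (intro eq_vecI) auto
  with s show ?thesis by (rule that)
qed

text \<open>On the cone of vectors \<open>U\<^sub>M s\<close> the sorted norm is linear in \<open>s\<close>: passing from ranks to
  values is monotone, so it commutes with sorting.\<close>

lemma sorted_l1_pattern_matrix_mult:
  assumes M: "patt M = M" and k: "real k = linf_norm M" and s: "s \<in> decreasing_positive k"
    and L: "\<Lambda> \<in> carrier_vec (dim_vec M)"
  shows "reduced_weights \<Lambda> M \<in> carrier_vec k"
    and "sorted_l1 \<Lambda> (pattern_matrix M *\<^sub>v s) = reduced_weights \<Lambda> M \<bullet> s"
proof -
  let ?N = "abs_sorted M" and ?p = "dim_vec M"
  let ?ranks = "(\<lambda>i. \<bar>M $ i\<bar>) ` {..<?p}"
  have sc: "s \<in> carrier_vec k" using s by (simp add: decreasing_positive_def)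
  have ranks: "\<exists>m\<le>k. x = real m" if "x \<in> ?ranks" for x
    using that abs_pattern[OF M] abs_le_linf_norm k by fastforce
  have N: "?N $ i \<in> ?ranks" if "i < ?p" for i
    using that abs_sorted_image[of M] by blast
  have N_abs: "\<bar>?N $ i\<bar> = ?N $ i" if "i < ?p" for i
    using ranks[OF N[OF that]] by auto
  have "{\<bar>?N $ i\<bar> | i. i < dim_vec ?N} = (\<lambda>i. ?N $ i) ` {..<?p}"
    using N_abs by force
  then have kN: "real k = linf_norm ?N"
    unfolding k linf_norm_def abs_sorted_image by (simp add: setcompr_eq_image lessThan_def)
  have U: "pattern_matrix ?N \<in> carrier_mat ?p k"
    using pattern_matrix_carrier[OF kN] by simp
  show "reduced_weights \<Lambda> M \<in> carrier_vec k"
    using U L by (simp add: reduced_weights_def)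
  have dim: "dim_vec (pattern_matrix M *\<^sub>v s) = ?p"
    using pattern_matrix_carrier[OF k] by simp
  have "abs_sorted (pattern_matrix M *\<^sub>v s) $ i = (pattern_matrix ?N *\<^sub>v s) $ i" if i: "i < ?p" for i
  proof -
    have "abs_sorted (pattern_matrix M *\<^sub>v s) $ i = cluster_value s (?N $ i)"
    proof (rule abs_sorted_mono_map[OF dim _ _ i])
      show "mono_on ?ranks (cluster_value s)"
      proof (rule mono_onI)
        fix x y assume "x \<in> ?ranks" "y \<in> ?ranks" "x \<le> y"
        then show "cluster_value s x \<le> cluster_value s y"
          using ranks[of x] ranks[of y] cluster_value_le_iff[OF s] by force
      qed
    qed (rule abs_pattern_matrix_mult[OF M k s])
    moreover have "(pattern_matrix ?N *\<^sub>v s) $ i = sgn (?N $ i) * cluster_value s (?N $ i)"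
      using pattern_matrix_mult_index[OF kN sc, of i] ranks[OF N[OF i]] N_abs[OF i] i
      by (auto simp: of_nat_in_Nats)
    moreover have "?N $ i = 0 \<or> sgn (?N $ i) = 1"
      using ranks[OF N[OF i]] by auto
    ultimately show ?thesis by (auto simp: cluster_value_def)
  qed
  then have "sorted_l1 \<Lambda> (pattern_matrix M *\<^sub>v s) = \<Lambda> \<bullet> (pattern_matrix ?N *\<^sub>v s)"
    using U dim by (simp add: sorted_l1_def scalar_prod_def atLeast0LessThan)
  also have "\<dots> = reduced_weights \<Lambda> M \<bullet> s"
    unfolding reduced_weights_def by (rule transpose_vec_mult_scalar[OF U sc L, symmetric])
  finally show "sorted_l1 \<Lambda> (pattern_matrix M *\<^sub>v s) = reduced_weights \<Lambda> M \<bullet> s" .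
qed

section \<open>Existence of the Moore-Penrose inverse\<close>

text \<open>Pivoting on a nonzero entry at \<open>(i, j)\<close>: the matrix \<open>E\<close> has the single entry \<open>1 / A $$ (i, j)\<close>
  at position \<open>(j, i)\<close>, and subtracting the rank one matrix \<open>A * E * A\<close> clears row \<open>i\<close> while it
  keeps every zero row. A generalized inverse of the remainder extends to one of \<open>A\<close>.\<close>

lemma exists_generalized_inverse:
  fixes A :: "'a::field mat"
  assumes "A \<in> carrier_mat m n"
  shows "\<exists>G \<in> carrier_mat n m. A * G * A = A"
  using assms
proof (induction "card {i. i < m \<and> (\<exists>j<n. A $$ (i, j) \<noteq> 0)}" arbitrary: A rule: less_induct)
  case less
  note A = less.prems
  show ?case
  proof (cases "\<exists>i j. i < m \<and> j < n \<and> A $$ (i, j) \<noteq> 0")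
    case False
    then have "A = 0\<^sub>m m n" using A by (intro eq_matI) auto
    then have "A * 0\<^sub>m n m * A = A" by simp
    then show ?thesis by (intro bexI[of _ "0\<^sub>m n m"]) simp_all
  next
    case True
    then obtain i j where i: "i < m" and j: "j < n" and pivot: "A $$ (i, j) \<noteq> 0" by blast
    define E where "E = mat n m (\<lambda>(r, c). if r = j \<and> c = i then 1 / A $$ (i, j) else 0)"
    have E: "E \<in> carrier_mat n m" by (simp add: E_def)
    have AE: "A * E \<in> carrier_mat m m" and EA: "E * A \<in> carrier_mat n n" using A E by auto
    have AE_index: "(A * E) $$ (r, c) = (if c = i then A $$ (r, j) / A $$ (i, j) else 0)"
      if "r < m" "c < m" for r c
    proof -
      have "(A * E) $$ (r, c) = (\<Sum>l = 0..<n. A $$ (r, l) * E $$ (l, c))"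
        using that A E by (simp add: scalar_prod_def)
      also have "\<dots> = (\<Sum>l = 0..<n. if l = j then (if c = i then A $$ (r, j) / A $$ (i, j) else 0) else 0)"
        by (intro sum.cong) (use that in \<open>auto simp: E_def\<close>)
      finally show ?thesis using j by simp
    qed
    have AEA_index: "(A * E * A) $$ (r, c) = A $$ (r, j) / A $$ (i, j) * A $$ (i, c)"
      if "r < m" "c < n" for r c
    proof -
      have "(A * E * A) $$ (r, c) = (\<Sum>l = 0..<m. (A * E) $$ (r, l) * A $$ (l, c))"
        using that A E AE by (simp add: scalar_prod_def del: assoc_mult_mat)
      also have "\<dots> = (\<Sum>l = 0..<m. if l = i then A $$ (r, j) / A $$ (i, j) * A $$ (i, c) else 0)"
        using that by (intro sum.cong) (auto simp: AE_index)
      finally show ?thesis using i by simp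
    qed
    define B where "B = A - A * E * A"
    have B: "B \<in> carrier_mat m n" using A E by (auto simp: B_def)
    have B_index: "B $$ (r, c) = A $$ (r, c) - A $$ (r, j) / A $$ (i, j) * A $$ (i, c)"
      if "r < m" "c < n" for r c
      using that A AE by (simp add: B_def AEA_index del: index_mult_mat(1))
    have "{r. r < m \<and> (\<exists>c<n. B $$ (r, c) \<noteq> 0)} \<subset> {r. r < m \<and> (\<exists>c<n. A $$ (r, c) \<noteq> 0)}"
    proof
      show "{r. r < m \<and> (\<exists>c<n. B $$ (r, c) \<noteq> 0)} \<subseteq> {r. r < m \<and> (\<exists>c<n. A $$ (r, c) \<noteq> 0)}"
      proof clarify
        fix r c assume rc: "r < m" "c < n" "B $$ (r, c) \<noteq> 0"
        then have "A $$ (r, c) \<noteq> 0 \<or> A $$ (r, j) \<noteq> 0" by (auto simp: B_index)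
        with rc j show "\<exists>c<n. A $$ (r, c) \<noteq> 0" by blast
      qed
      have "i \<notin> {r. r < m \<and> (\<exists>c<n. B $$ (r, c) \<noteq> 0)}"
        using i pivot by (auto simp: B_index)
      moreover have "i \<in> {r. r < m \<and> (\<exists>c<n. A $$ (r, c) \<noteq> 0)}"
        using i j pivot by auto
      ultimately show "{r. r < m \<and> (\<exists>c<n. B $$ (r, c) \<noteq> 0)} \<noteq> {r. r < m \<and> (\<exists>c<n. A $$ (r, c) \<noteq> 0)}"
        by blast
    qed
    then have "card {r. r < m \<and> (\<exists>c<n. B $$ (r, c) \<noteq> 0)} < card {r. r < m \<and> (\<exists>c<n. A $$ (r, c) \<noteq> 0)}"
      by (intro psubset_card_mono) simp_all
    from less.hyps[OF this B] obtain G where G: "G \<in> carrier_mat n m" and BGB: "B * G * B = B" by blast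
    \<comment> \<open>As \<open>P * A = A * Q = A - A * E * A\<close>, the matrix \<open>Q * G * P + E\<close> reproduces both parts of \<open>A\<close>.\<close>
    define P Q where "P = 1\<^sub>m m - A * E" and "Q = 1\<^sub>m n - E * A"
    have P: "P \<in> carrier_mat m m" and Q: "Q \<in> carrier_mat n n"
      by (simp_all add: P_def Q_def minus_carrier_mat[OF AE] minus_carrier_mat[OF EA])
    have PA: "P * A = B"
      unfolding P_def B_def minus_mult_distrib_mat[OF one_carrier_mat AE A] left_mult_one_mat[OF A] ..
    have AQ: "A * Q = B"
      unfolding Q_def B_def mult_minus_distrib_mat[OF A one_carrier_mat EA] right_mult_one_mat[OF A]
        assoc_mult_mat[OF A E A] ..
    have QG: "Q * G \<in> carrier_mat n m" and AQc: "A * Q \<in> carrier_mat m n"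
      using A Q G by auto
    have QGP: "Q * G * P \<in> carrier_mat n m" and AQG: "A * Q * G \<in> carrier_mat m m"
      using mult_carrier_mat[OF QG P] mult_carrier_mat[OF AQc G] by auto
    have "A * (Q * G * P) * A = A * Q * G * (P * A)"
      by (simp only: assoc_mult_mat[OF A QG P, symmetric] assoc_mult_mat[OF A Q G, symmetric]
          assoc_mult_mat[OF AQG P A])
    also have "\<dots> = B" by (simp only: PA AQ BGB)
    finally have main: "A * (Q * G * P) * A = B" .
    have "A * (Q * G * P + E) * A = A * (Q * G * P) * A + A * E * A"
      by (simp only: mult_add_distrib_mat[OF A QGP E] add_mult_distrib_mat[OF mult_carrier_mat[OF A QGP] AE A])
    also have "\<dots> = A"
    proof -
      have "A - K + K = A" if "K \<in> carrier_mat m n" for K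
        using A that by auto
      then show ?thesis unfolding main B_def using mult_carrier_mat[OF AE A] .
    qed
    finally show ?thesis using QGP E by (intro bexI[of _ "Q * G * P + E"] add_carrier_mat)
  qed
qed

lemma transpose_mult_self_eq_0D:
  fixes B :: "real mat"
  assumes B: "B \<in> carrier_mat m n" and 0: "transpose_mat B * B = 0\<^sub>m n n"
  shows "B = 0\<^sub>m m n"
proof (rule eq_matI)
  fix r c assume rc: "r < dim_row (0\<^sub>m m n :: real mat)" "c < dim_col (0\<^sub>m m n :: real mat)"
  have "(\<Sum>i = 0..<m. B $$ (i, c) * B $$ (i, c)) = (transpose_mat B * B) $$ (c, c)"
    using rc B by (simp add: scalar_prod_def)
  also have "\<dots> = 0" unfolding 0 using rc by simp
  finally have "\<forall>i\<in>{0..<m}. B $$ (i, c) * B $$ (i, c) = 0"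
    by (subst (asm) sum_nonneg_eq_0_iff) simp_all
  then show "B $$ (r, c) = 0\<^sub>m m n $$ (r, c)" using rc by simp
qed (use B in auto)

text \<open>If \<open>G\<close> is a generalized inverse of \<open>A\<^sup>T A\<close>, then \<open>G A\<^sup>T\<close> solves the least squares
  problem: \<open>A G A\<^sup>T\<close> is the orthogonal projection onto the column space.\<close>

lemma exists_least_squares_inverse:
  fixes A :: "real mat"
  assumes A: "A \<in> carrier_mat m n"
  shows "\<exists>L \<in> carrier_mat n m. A * L * A = A \<and> transpose_mat (A * L) = A * L"
proof -
  let ?T = "transpose_mat A"
  have T: "?T \<in> carrier_mat n m" using A by simp
  define S where "S = ?T * A"
  have S: "S \<in> carrier_mat n n" using A by (auto simp: S_def)
  have S_sym: "transpose_mat S = S" using A by (simp add: S_def transpose_mult[OF T A])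
  obtain G where G: "G \<in> carrier_mat n n" and SGS: "S * G * S = S"
    using exists_generalized_inverse[OF S] by blast
  have GS: "G * S \<in> carrier_mat n n" using G S by auto
  \<comment> \<open>The matrix \<open>A\<close> can be cancelled in \<open>S Z = 0\<close>, because \<open>(A Z)\<^sup>T (A Z) = Z\<^sup>T S Z\<close>.\<close>
  define Z where "Z = G * S - 1\<^sub>m n"
  have Z: "Z \<in> carrier_mat n n" using GS by (auto simp: Z_def)
  have AZ: "A * Z \<in> carrier_mat m n" using mult_carrier_mat[OF A Z] .
  have eq_if_diff_0: "K = K'"
    if "K \<in> carrier_mat a b" "K' \<in> carrier_mat a b" "K - K' = 0\<^sub>m a b" for K K' :: "real mat" and a b
  proof (rule eq_matI)
    fix i j assume "i < dim_row K'" "j < dim_col K'"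
    then show "K $$ (i, j) = K' $$ (i, j)"
      using that(1,2) arg_cong[OF that(3), of "\<lambda>D. D $$ (i, j)"] by simp
  qed (use that in simp_all)
  have "S * Z = S * (G * S) - S"
    unfolding Z_def by (simp only: mult_minus_distrib_mat[OF S GS one_carrier_mat] right_mult_one_mat[OF S])
  also have "S * (G * S) = S" using assoc_mult_mat[OF S G S] SGS by simp
  also have "S - S = 0\<^sub>m n n" using S by simp
  finally have SZ: "S * Z = 0\<^sub>m n n" .
  have "transpose_mat (A * Z) * (A * Z) = transpose_mat Z * ?T * (A * Z)"
    by (simp only: transpose_mult[OF A Z])
  also have "\<dots> = transpose_mat Z * (?T * (A * Z))"
    by (rule assoc_mult_mat[OF _ T AZ]) (use Z in simp)
  also have "?T * (A * Z) = 0\<^sub>m n n"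
    using assoc_mult_mat[OF T A Z] SZ by (simp add: S_def)
  also have "transpose_mat Z * 0\<^sub>m n n = 0\<^sub>m n n" using Z by simp
  finally have "A * Z = 0\<^sub>m m n" by (rule transpose_mult_self_eq_0D[OF AZ])
  then have "A * (G * S) - A = 0\<^sub>m m n"
    unfolding Z_def by (simp only: mult_minus_distrib_mat[OF A GS one_carrier_mat] right_mult_one_mat[OF A])
  with mult_carrier_mat[OF A GS] A have AGS: "A * (G * S) = A"
    by (rule eq_if_diff_0)
  have AG: "A * G \<in> carrier_mat m n" using mult_carrier_mat[OF A G] .
  define H where "H = A * G * ?T"
  have H: "H \<in> carrier_mat m m" unfolding H_def using mult_carrier_mat[OF AG T] .
  then have H': "transpose_mat H \<in> carrier_mat m m" by simp
  have HA: "H * A = A"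
    unfolding H_def assoc_mult_mat[OF AG T A] S_def[symmetric] assoc_mult_mat[OF A G S] by (rule AGS)
  \<comment> \<open>Transposing \<open>H A = A\<close> gives \<open>A\<^sup>T H\<^sup>T = A\<^sup>T\<close>, so that \<open>H = H H\<^sup>T\<close> is symmetric.\<close>
  have TH: "?T * transpose_mat H = ?T" using transpose_mult[OF H A] by (simp only: HA)
  have HHT: "H = H * transpose_mat H"
    using assoc_mult_mat[OF AG T H'] by (simp only: TH H_def[symmetric])
  have "transpose_mat H = H * transpose_mat H"
    using arg_cong[OF HHT, of transpose_mat] by (simp only: transpose_mult[OF H H'] transpose_transpose)
  with HHT have "transpose_mat H = H" by simp
  moreover have "A * (G * ?T) = H" unfolding H_def using assoc_mult_mat[OF A G T] by simp
  ultimately show ?thesis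
    using HA mult_carrier_mat[OF G T] by (intro bexI[of _ "G * ?T"]) simp_all
qed

text \<open>A generalized inverse \<open>L\<close> with \<open>A L\<close> symmetric and a generalized inverse \<open>N\<close> with \<open>N A\<close>
  symmetric combine to the Moore-Penrose inverse \<open>N A L\<close>, since \<open>A (N A L) = A L\<close> and
  \<open>(N A L) A = N A\<close>. Such an \<open>N\<close> is the transpose of a least squares inverse of \<open>A\<^sup>T\<close>.\<close>

lemma is_mp_inverse_mp_inverse: "is_mp_inverse A (mp_inverse A)"
proof -
  define m n where "m = dim_row A" and "n = dim_col A"
  let ?T = "transpose_mat A"
  have A: "A \<in> carrier_mat m n" and T: "?T \<in> carrier_mat n m" by (simp_all add: m_def n_def)
  obtain L where L: "L \<in> carrier_mat n m" and ALA: "A * L * A = A"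
    and AL: "transpose_mat (A * L) = A * L"
    using exists_least_squares_inverse[OF A] by blast
  obtain R where R: "R \<in> carrier_mat m n" and TRT: "?T * R * ?T = ?T"
    and TR: "transpose_mat (?T * R) = ?T * R"
    using exists_least_squares_inverse[OF T] by blast
  define N where "N = transpose_mat R"
  have N: "N \<in> carrier_mat n m" using R by (simp add: N_def)
  have NAc: "N * A \<in> carrier_mat n n" using mult_carrier_mat[OF N A] .
  have NAL: "N * A * L \<in> carrier_mat n m" using mult_carrier_mat[OF NAc L] .
  have NA: "N * A = transpose_mat (?T * R)"
    by (simp only: N_def transpose_mult[OF T R] transpose_transpose)
  have NA_sym: "transpose_mat (N * A) = N * A" by (simp only: NA TR)
  have ANA: "A * (N * A) = A"
    using arg_cong[OF TRT, of transpose_mat]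
    by (simp only: NA transpose_mult[OF mult_carrier_mat[OF T R] T] transpose_transpose)
  have 1: "A * (N * A * L) = A * L"
    by (simp only: assoc_mult_mat[OF A NAc L, symmetric] ANA)
  have LA: "A * (L * A) = A"
    by (simp only: assoc_mult_mat[OF A L A, symmetric] ALA)
  have 2: "N * A * L * A = N * A"
    by (simp only: assoc_mult_mat[OF NAc L A] assoc_mult_mat[OF N A mult_carrier_mat[OF L A]] LA)
  have 3: "N * A * (N * A * L) = N * A * L"
    unfolding assoc_mult_mat[OF N A NAL] 1 by (rule assoc_mult_mat[OF N A L, symmetric])
  have *: "is_mp_inverse A (N * A * L)"
    unfolding is_mp_inverse_def 1 2 3 using AL NA_sym ALA NAL by (simp only: m_def n_def simp_thms)
  show ?thesis
    unfolding mp_inverse_def by (rule theI[where P = "is_mp_inverse A", OF *]) (rule is_mp_inverse_unique[OF _ *])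
qed

lemma mp_inverse_transpose: "mp_inverse (transpose_mat A) = transpose_mat (mp_inverse A)"
proof (rule is_mp_inverse_unique[OF is_mp_inverse_mp_inverse])
  define B where "B = mp_inverse A"
  define m n where "m = dim_row A" and "n = dim_col A"
  have mp: "is_mp_inverse A B" unfolding B_def by (rule is_mp_inverse_mp_inverse)
  have A: "A \<in> carrier_mat m n" and B: "B \<in> carrier_mat n m"
    using mp by (auto simp: is_mp_inverse_def m_def n_def)
  let ?A = "transpose_mat A" and ?B = "transpose_mat B"
  have A': "?A \<in> carrier_mat n m" and B': "?B \<in> carrier_mat m n" using A B by auto
  have "A * B * A = A" "B * A * B = B"
    and "transpose_mat (A * B) = A * B" "transpose_mat (B * A) = B * A"
    using mp by (simp_all add: is_mp_inverse_def)
  note BAB = this(1,2)[THEN arg_cong[where f = transpose_mat]] and sym = this(3,4)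
  have "?A * ?B * ?A = ?A" "?B * ?A * ?B = ?B"
    using BAB
    by (simp_all only: transpose_mult[OF mult_carrier_mat[OF A B] A] transpose_mult[OF mult_carrier_mat[OF B A] B]
        transpose_mult[OF A B] transpose_mult[OF B A] assoc_mult_mat[OF A' B' A'] assoc_mult_mat[OF B' A' B'])
  moreover have "?A * ?B = B * A" "?B * ?A = A * B"
    using sym by (simp_all only: transpose_mult[OF A B] transpose_mult[OF B A])
  ultimately show "is_mp_inverse ?A (transpose_mat (mp_inverse A))"
    unfolding is_mp_inverse_def B_def[symmetric] using sym A' B' by simp
qed

section \<open>The subdifferential along a pattern\<close>

lemma decreasing_positive_perturb:
  assumes s: "s \<in> decreasing_positive k" and d: "d \<in> carrier_vec k"
  obtains t where "0 < t" and "s - t \<cdot>\<^sub>v d \<in> decreasing_positive k"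
proof -
  have pos: "\<forall>\<^sub>F t in at_right 0. 0 < c - t * q" if "0 < c" for c q :: real
  proof -
    have "((\<lambda>t. c - t * q) \<longlongrightarrow> c - 0 * q) (at_right 0)"
      by (intro tendsto_intros)
    then show ?thesis using that by (intro order_tendstoD(1)[where y = "c - 0 * q"]) simp_all
  qed
  have "\<forall>\<^sub>F t in at_right 0. \<forall>i\<in>{..<k}. 0 < s $ i - t * d $ i"
    using s by (intro eventually_ball_finite ballI pos) (auto simp: decreasing_positive_def)
  moreover have "\<forall>\<^sub>F t in at_right 0. \<forall>j\<in>{..<k}. \<forall>i\<in>{..<j}. 0 < (s $ i - s $ j) - t * (d $ i - d $ j)"
    using s by (intro eventually_ball_finite ballI pos) (auto simp: decreasing_positive_def)
  moreover have "\<forall>\<^sub>F t::real in at_right 0. 0 < t"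
    by (rule eventually_at_right_less)
  ultimately have "\<forall>\<^sub>F t in at_right 0. 0 < t \<and> s - t \<cdot>\<^sub>v d \<in> decreasing_positive k"
  proof eventually_elim
    case (elim t)
    then show ?case
      using s d by (fastforce simp: decreasing_positive_def algebra_simps)
  qed
  then obtain t where "0 < t \<and> s - t \<cdot>\<^sub>v d \<in> decreasing_positive k"
    using eventually_happens' trivial_limit_at_right_real by blast
  then show ?thesis using that by blast
qed

text \<open>Since \<open>decreasing_positive k\<close> is open, a linear inequality on it that is tight at one of
  its points is an equality of linear forms. Applied to \<open>v \<bullet> U\<^sub>M s \<le> sorted_l1 \<Lambda> (U\<^sub>M s)\<close>, whose
  right side is linear in \<open>s\<close>, this determines \<open>U\<^sub>M\<^sup>T v\<close>. The right side of the equivalence does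
  not contain \<open>s\<close>: the subdifferential depends on the pattern alone.\<close>

lemma subdiff_pattern_matrix_mult_iff:
  assumes M: "patt M = M" and k: "real k = linf_norm M" and L: "\<Lambda> \<in> carrier_vec (dim_vec M)"
    and s: "s \<in> decreasing_positive k"
  shows "v \<in> subdiff_sorted_l1 \<Lambda> (pattern_matrix M *\<^sub>v s) \<longleftrightarrow>
    v \<in> carrier_vec (dim_vec M) \<and> (\<forall>z \<in> carrier_vec (dim_vec M). v \<bullet> z \<le> sorted_l1 \<Lambda> z) \<and>
    transpose_mat (pattern_matrix M) *\<^sub>v v = reduced_weights \<Lambda> M"
proof -
  let ?U = "pattern_matrix M" and ?W = "reduced_weights \<Lambda> M"
  have U: "?U \<in> carrier_mat (dim_vec M) k" by (rule pattern_matrix_carrier[OF k])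
  have W: "?W \<in> carrier_vec k" by (rule sorted_l1_pattern_matrix_mult(1)[OF M k s L])
  have carrier: "s' \<in> carrier_vec k" if "s' \<in> decreasing_positive k" for s'
    using that by (simp add: decreasing_positive_def)
  have Us: "?U *\<^sub>v s \<in> carrier_vec (dim_vec M)" using U carrier[OF s] by auto
  note linear = sorted_l1_pattern_matrix_mult(2)[OF M k _ L]
  show ?thesis
    unfolding subdiff_sorted_l1_iff[OF Us]
  proof (intro iffI conjI; (elim conjE)?)
    assume v: "v \<in> carrier_vec (dim_vec M)"
      and tight: "v \<bullet> (?U *\<^sub>v s) = sorted_l1 \<Lambda> (?U *\<^sub>v s)"
      and dual: "\<forall>z \<in> carrier_vec (dim_vec M). v \<bullet> z \<le> sorted_l1 \<Lambda> z"
    define w where "w = transpose_mat ?U *\<^sub>v v"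
    define d where "d = ?W - w"
    have w: "w \<in> carrier_vec k" using U v by (auto simp: w_def)
    have d: "d \<in> carrier_vec k" using w W by (simp add: d_def)
    have diff: "d \<bullet> s' = sorted_l1 \<Lambda> (?U *\<^sub>v s') - v \<bullet> (?U *\<^sub>v s')" if "s' \<in> decreasing_positive k" for s'
      using minus_scalar_prod_distrib[OF W w carrier[OF that]] linear[OF that]
        transpose_vec_mult_scalar[OF U carrier[OF that] v] by (simp add: d_def w_def)
    \<comment> \<open>The gap \<open>d \<bullet> s'\<close> is nonnegative on the cone and vanishes at \<open>s\<close>, so a step against \<open>d\<close>
      that stays in the cone forces \<open>d = 0\<close>.\<close>
    obtain t where t: "0 < t" "s - t \<cdot>\<^sub>v d \<in> decreasing_positive k"
      using decreasing_positive_perturb[OF s d] .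
    have "0 \<le> d \<bullet> (s - t \<cdot>\<^sub>v d)"
      using diff[OF t(2)] dual U carrier[OF t(2)] by simp
    also have "\<dots> = d \<bullet> s - t * (d \<bullet> d)"
      using scalar_prod_minus_distrib[OF d carrier[OF s], of "t \<cdot>\<^sub>v d"] d by simp
    also have "d \<bullet> s = 0" using diff[OF s] tight by simp
    finally have "d \<bullet> d \<le> 0" using t(1) by (simp add: mult_le_0_iff)
    moreover have "0 \<le> (\<Sum>i = 0..<k. d $ i * d $ i)" by (simp add: sum_nonneg)
    ultimately have "(\<Sum>i = 0..<k. d $ i * d $ i) = 0" using d by (simp add: scalar_prod_def)
    then have "d $ i = 0" if "i < k" for i
      using that by (subst (asm) sum_nonneg_eq_0_iff) auto
    then show "transpose_mat ?U *\<^sub>v v = ?W"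
      unfolding w_def[symmetric] using w W by (intro eq_vecI) (auto simp: d_def)
  next
    assume v: "v \<in> carrier_vec (dim_vec M)" and eq: "transpose_mat ?U *\<^sub>v v = ?W"
    show "v \<bullet> (?U *\<^sub>v s) = sorted_l1 \<Lambda> (?U *\<^sub>v s)"
      using transpose_vec_mult_scalar[OF U carrier[OF s] v] linear[OF s] eq by simp
  qed
qed

lemma subdiff_pattern:
  assumes p: "0 < dim_vec M" and M: "patt M = M" and k: "real k = linf_norm M"
    and L: "\<Lambda> \<in> carrier_vec (dim_vec M)" and s: "s \<in> decreasing_positive k"
  shows "subdiff_sorted_l1 \<Lambda> (pattern_matrix M *\<^sub>v s) = subdiff_sorted_l1 \<Lambda> M"
proof -
  obtain r where r: "r \<in> decreasing_positive k" and "M = pattern_matrix M *\<^sub>v r"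
    using pattern_decomposition[OF p] M k by metis
  then have "v \<in> subdiff_sorted_l1 \<Lambda> (pattern_matrix M *\<^sub>v s) \<longleftrightarrow> v \<in> subdiff_sorted_l1 \<Lambda> M" for v
    using subdiff_pattern_matrix_mult_iff[OF M k L s, of v] subdiff_pattern_matrix_mult_iff[OF M k L r, of v]
    by simp
  then show ?thesis by blast
qed

section \<open>Characterization of pattern recovery\<close>

text \<open>Positivity says that \<open>W = A\<^sup>T r\<close>, where \<open>A\<close> is the reduced design, \<open>W\<close> are the reduced weights
  and \<open>r = Y - A s\<close> is the residual. Then \<open>(A\<^sup>T)\<^sup>+ W = P r = P Y - A s\<close> for the projection
  \<open>P = A A\<^sup>+\<close>, and adding \<open>(I - P) Y\<close> gives the residual back.\<close>

lemma slope_pi_eq: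
  assumes X: "X \<in> carrier_mat n p" and U: "pattern_matrix M \<in> carrier_mat p k"
    and Y: "Y \<in> carrier_vec n" and s: "s \<in> carrier_vec k" and W: "reduced_weights \<Lambda> M \<in> carrier_vec k"
    and pos: "positivity_at X \<Lambda> Y M s"
  shows "slope_pi X \<Lambda> Y M = transpose_mat X *\<^sub>v (Y - X *\<^sub>v (pattern_matrix M *\<^sub>v s))"
proof -
  define A where "A = reduced_design X M"
  define B where "B = mp_inverse A"
  define W where "W = reduced_weights \<Lambda> M"
  have A: "A \<in> carrier_mat n k" unfolding A_def reduced_design_def using mult_carrier_mat[OF X U] .
  have mp: "is_mp_inverse A B" unfolding B_def by (rule is_mp_inverse_mp_inverse)
  have B: "B \<in> carrier_mat k n" using mp A by (auto simp: is_mp_inverse_def)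
  have AB: "A * B \<in> carrier_mat n n" using mult_carrier_mat[OF A B] .
  have AT: "transpose_mat A \<in> carrier_mat k n" and BT: "transpose_mat B \<in> carrier_mat n k"
    using A B by simp_all
  have As: "A *\<^sub>v s \<in> carrier_vec n" using A s by simp
  define r where "r = Y - A *\<^sub>v s"
  have r: "r \<in> carrier_vec n" using Y As by (simp add: r_def)
  have "transpose_mat A *\<^sub>v Y - W = transpose_mat A *\<^sub>v (A *\<^sub>v s)"
    using pos by (simp add: positivity_at_def A_def W_def)
  then have "transpose_mat A *\<^sub>v Y - transpose_mat A *\<^sub>v (A *\<^sub>v s)
      = transpose_mat A *\<^sub>v Y - (transpose_mat A *\<^sub>v Y - W)"
    by (simp only:)
  also have "\<dots> = W"
    using W AT Y by (intro eq_vecI) (auto simp: W_def)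
  finally have "W = transpose_mat A *\<^sub>v r"
    unfolding r_def mult_minus_distrib_mat_vec[OF AT Y As] by simp
  then have "transpose_mat B *\<^sub>v W = transpose_mat B * transpose_mat A *\<^sub>v r"
    by (simp only: assoc_mult_mat_vec[OF BT AT r])
  also have "transpose_mat B * transpose_mat A = A * B"
    using mp transpose_mult[OF A B] by (simp only: is_mp_inverse_def)
  also have "A * B *\<^sub>v r = A * B *\<^sub>v Y - A * B *\<^sub>v (A *\<^sub>v s)"
    unfolding r_def by (rule mult_minus_distrib_mat_vec[OF AB Y As])
  also have "A * B *\<^sub>v (A *\<^sub>v s) = A *\<^sub>v s"
    using mp assoc_mult_mat_vec[OF AB A s] by (simp only: is_mp_inverse_def)
  finally have BW: "transpose_mat B *\<^sub>v W = A * B *\<^sub>v Y - A *\<^sub>v s" .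
  have proj: "(1\<^sub>m n - A * B) *\<^sub>v Y = Y - A * B *\<^sub>v Y"
    using minus_mult_distrib_mat_vec[OF one_carrier_mat AB Y] Y by (simp only: one_mult_mat_vec)
  have PY: "A * B *\<^sub>v Y \<in> carrier_vec n" using mult_mat_vec_carrier[OF AB Y] .
  have "slope_pi X \<Lambda> Y M = transpose_mat X *\<^sub>v (A * B *\<^sub>v Y - A *\<^sub>v s) + transpose_mat X *\<^sub>v (Y - A * B *\<^sub>v Y)"
    unfolding slope_pi_def reduced_projection_def
    unfolding A_def[symmetric] B_def[symmetric] mp_inverse_transpose W_def[symmetric] BW
      carrier_matD(1)[OF X] proj ..
  also have "\<dots> = transpose_mat X *\<^sub>v ((A * B *\<^sub>v Y - A *\<^sub>v s) + (Y - A * B *\<^sub>v Y))"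
    by (rule mult_add_distrib_mat_vec[symmetric, where nr = p and nc = n]) (use X Y PY As in simp_all)
  also have "(A * B *\<^sub>v Y - A *\<^sub>v s) + (Y - A * B *\<^sub>v Y) = Y - A *\<^sub>v s"
  proof -
    have "(a - b) + (c - a) = c - b"
      if "a \<in> carrier_vec n" "b \<in> carrier_vec n" "c \<in> carrier_vec n" for a b c :: "real vec"
      using that by auto
    from this[OF PY As Y] show ?thesis .
  qed
  also have "A *\<^sub>v s = X *\<^sub>v (pattern_matrix M *\<^sub>v s)"
    unfolding A_def reduced_design_def by (rule assoc_mult_mat_vec[OF X U s])
  finally show ?thesis .
qed

theorem theorem3p1:
  fixes X :: "real mat" and \<beta> \<epsilon> Y \<Lambda> M \<pi> :: "real vec" and n p k :: nat
  assumes "X \<in> carrier_mat n p"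
    and "\<beta> \<in> carrier_vec p" and "\<beta> \<noteq> 0\<^sub>v p"
    and "\<epsilon> \<in> carrier_vec n"
    and "Y = X *\<^sub>v \<beta> + \<epsilon>"
    and "\<Lambda> \<in> decreasing_positive p"
    and "M = patt \<beta>"
    and "real k = linf_norm M"
    and "\<pi> = slope_pi X \<Lambda> Y M"
  shows "((\<exists>\<beta>h \<in> slope_minimizers X \<Lambda> Y. patt \<beta>h = patt \<beta>) \<longleftrightarrow>
            (\<exists>s \<in> decreasing_positive k. positivity_at X \<Lambda> Y M s) \<and>
            \<pi> \<in> subdiff_sorted_l1 \<Lambda> M)
       \<and> (\<forall>s \<in> decreasing_positive k.
            positivity_at X \<Lambda> Y M s \<and> \<pi> \<in> subdiff_sorted_l1 \<Lambda> M \<longrightarrow>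
              pattern_matrix M *\<^sub>v s \<in> slope_minimizers X \<Lambda> Y \<and>
              \<pi> = transpose_mat X *\<^sub>v (Y - X *\<^sub>v (pattern_matrix M *\<^sub>v s)))"
proof -
  note X = assms(1) and k = assms(8)
  let ?U = "pattern_matrix M" and ?W = "reduced_weights \<Lambda> M"
  have Y: "Y \<in> carrier_vec n" using assms by simp
  have p: "0 < p" using assms(2,3) by (cases p) auto
  have dim: "dim_vec M = p" using assms by simp
  have M: "patt M = M" by (simp add: assms(7) patt_patt)
  have L: "\<Lambda> \<in> carrier_vec (dim_vec M)" using assms(6) dim by (simp add: decreasing_positive_def)
  have U: "?U \<in> carrier_mat p k" using pattern_matrix_carrier[OF k] dim by simp
  have carrier: "s \<in> carrier_vec k" "?U *\<^sub>v s \<in> carrier_vec p" if "s \<in> decreasing_positive k" for s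
    using that U by (auto simp: decreasing_positive_def)
  have pi: "\<pi> = transpose_mat X *\<^sub>v (Y - X *\<^sub>v (?U *\<^sub>v s))"
    if s: "s \<in> decreasing_positive k" and "positivity_at X \<Lambda> Y M s" for s
    unfolding assms(9) using that(2)
    by (rule slope_pi_eq[OF X U Y carrier(1)[OF s] sorted_l1_pattern_matrix_mult(1)[OF M k s L]])
  have minimizer_iff: "?U *\<^sub>v s \<in> slope_minimizers X \<Lambda> Y \<longleftrightarrow>
      transpose_mat X *\<^sub>v (Y - X *\<^sub>v (?U *\<^sub>v s)) \<in> subdiff_sorted_l1 \<Lambda> M"
    if s: "s \<in> decreasing_positive k" for s
    using slope_minimizers_iff[OF X Y assms(6) carrier(2)[OF s]] subdiff_pattern[OF _ M k L s] p dim
    by simp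
  have sufficient: "?U *\<^sub>v s \<in> slope_minimizers X \<Lambda> Y"
    if "s \<in> decreasing_positive k" "positivity_at X \<Lambda> Y M s" "\<pi> \<in> subdiff_sorted_l1 \<Lambda> M" for s
    using minimizer_iff[OF that(1)] pi[OF that(1,2)] that(3) by simp
  have necessary: "(\<exists>s \<in> decreasing_positive k. positivity_at X \<Lambda> Y M s) \<and> \<pi> \<in> subdiff_sorted_l1 \<Lambda> M"
    if b: "b \<in> slope_minimizers X \<Lambda> Y" and patt_b: "patt b = patt \<beta>" for b
  proof -
    have "b \<in> carrier_vec p"
      using b X by (simp add: slope_minimizers_def is_arg_min_def)
    then obtain s where s: "s \<in> decreasing_positive k" and bs: "b = ?U *\<^sub>v s"
      using pattern_decomposition[of b k] p k patt_b assms(7) by (metis carrier_vecD)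
    let ?r = "Y - X *\<^sub>v (?U *\<^sub>v s)"
    have sub: "transpose_mat X *\<^sub>v ?r \<in> subdiff_sorted_l1 \<Lambda> (?U *\<^sub>v s)"
      using slope_minimizers_iff[OF X Y assms(6) carrier(2)[OF s]] b bs by simp
    then have W: "transpose_mat ?U *\<^sub>v (transpose_mat X *\<^sub>v ?r) = ?W"
      using subdiff_pattern_matrix_mult_iff[OF M k L s] by blast
    have Xs: "X *\<^sub>v (?U *\<^sub>v s) \<in> carrier_vec n" using mult_mat_vec_carrier[OF X carrier(2)[OF s]] .
    have T: "transpose_mat (X * ?U) \<in> carrier_mat k n" using mult_carrier_mat[OF X U] by simp
    have "?W = transpose_mat (X * ?U) *\<^sub>v ?r"
      unfolding transpose_mult[OF X U] W[symmetric]
      by (rule assoc_mult_mat_vec[symmetric, of _ k p _ n]) (use X U minus_carrier_vec[OF Y Xs] in simp_all)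
    also have "\<dots> = transpose_mat (X * ?U) *\<^sub>v Y - transpose_mat (X * ?U) *\<^sub>v (X *\<^sub>v (?U *\<^sub>v s))"
      by (rule mult_minus_distrib_mat_vec[OF T Y Xs])
    finally have W_eq: "?W = transpose_mat (X * ?U) *\<^sub>v Y - transpose_mat (X * ?U) *\<^sub>v (X *\<^sub>v (?U *\<^sub>v s))" .
    have "a - (a - c) = c" if "a \<in> carrier_vec k" "c \<in> carrier_vec k" for a c :: "real vec"
      using that by auto
    from this[OF mult_mat_vec_carrier[OF T Y] mult_mat_vec_carrier[OF T Xs]]
    have pos: "positivity_at X \<Lambda> Y M s"
      unfolding positivity_at_def reduced_design_def W_eq assoc_mult_mat_vec[OF X U carrier(1)[OF s]] .
    then show ?thesis
      using s sub pi[OF s pos] subdiff_pattern[OF _ M k L s] p dim by auto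
  qed
  show ?thesis
    using sufficient necessary pi patt_pattern_matrix_mult[OF M k] assms(7) by metis
qed

end
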